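(* Let $L$ be a Latin square of order $n\ge2$ in which the minimum deficit of a partial transversal is $d$. Then: (1) the minimum size of a cover of $L$ is $n+\lceil d/2 \rceil$; (2) any partial transversal of $L$ of deficit $d$ is contained in a minimum cover of $L$; (3) any minimum cover of $L$ contains a partial transversal of deficit $d$ if $d$ is even, or of deficit $d+1$ if $d$ is odd; (4) if $d$ is even, then for any minimum cover $\mathscr{C}$ of $L$ and any entry $\mathbf{e}\in\mathscr{C}$, $\mathscr{C}$ contains a partial transversal of deficit $d$ that contains $\mathbf{e}$.
   Context: A Latin square of order $n$ is an $n\times n$ array on $n$ symbols in which each symbol occurs once in each row and each column; its set of entries is $E(L)=\{(i,j,L_{ij})\}$. A line is the set of all entries in a given row, in a given column, or with a given symbol. A cover is a subset of $E(L)$ meeting every line; a cover is minimum if no cover of $L$ has smaller size. A partial transversal of deficit $d$ is an $(n-d)$-subset of $E(L)$ in which every line is represented at most once. *)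

theory Defs
  imports Complex_Main
begin

text \<open>
  An array of order \<open>n\<close> is a function \<open>L\<close> of which only the values \<open>L i j\<close> with \<open>i, j < n\<close> matter;
  rows and columns are indexed by \<open>{..<n}\<close>, and the symbols form an arbitrary set \<open>S\<close> with
  \<open>n\<close> elements.
\<close>

definition latin_square :: "nat \<Rightarrow> 'a set \<Rightarrow> (nat \<Rightarrow> nat \<Rightarrow> 'a) \<Rightarrow> bool" where
  "latin_square n S L \<longleftrightarrow>
     finite S \<and> card S = n \<and>
     (\<forall>i<n. \<forall>j<n. L i j \<in> S) \<and>
     (\<forall>i<n. \<forall>s\<in>S. \<exists>!j. j < n \<and> L i j = s) \<and>
     (\<forall>j<n. \<forall>s\<in>S. \<exists>!i. i < n \<and> L i j = s)"

definition entries :: "nat \<Rightarrow> (nat \<Rightarrow> nat \<Rightarrow> 'a) \<Rightarrow> (nat \<times> nat \<times> 'a) set" where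
  "entries n L = {(i, j, L i j) | i j. i < n \<and> j < n}"

definition row_line :: "nat \<Rightarrow> (nat \<Rightarrow> nat \<Rightarrow> 'a) \<Rightarrow> nat \<Rightarrow> (nat \<times> nat \<times> 'a) set" where
  "row_line n L r = {(i, j, s) \<in> entries n L. i = r}"

definition column_line :: "nat \<Rightarrow> (nat \<Rightarrow> nat \<Rightarrow> 'a) \<Rightarrow> nat \<Rightarrow> (nat \<times> nat \<times> 'a) set" where
  "column_line n L c = {(i, j, s) \<in> entries n L. j = c}"

definition symbol_line :: "nat \<Rightarrow> (nat \<Rightarrow> nat \<Rightarrow> 'a) \<Rightarrow> 'a \<Rightarrow> (nat \<times> nat \<times> 'a) set" where
  "symbol_line n L a = {(i, j, s) \<in> entries n L. s = a}"

definition lines :: "nat \<Rightarrow> 'a set \<Rightarrow> (nat \<Rightarrow> nat \<Rightarrow> 'a) \<Rightarrow> (nat \<times> nat \<times> 'a) set set" where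
  "lines n S L = row_line n L ` {..<n} \<union> column_line n L ` {..<n} \<union> symbol_line n L ` S"

definition cover ::
  "nat \<Rightarrow> 'a set \<Rightarrow> (nat \<Rightarrow> nat \<Rightarrow> 'a) \<Rightarrow> (nat \<times> nat \<times> 'a) set \<Rightarrow> bool" where
  "cover n S L C \<longleftrightarrow> C \<subseteq> entries n L \<and> (\<forall>l\<in>lines n S L. C \<inter> l \<noteq> {})"

definition minimum_cover ::
  "nat \<Rightarrow> 'a set \<Rightarrow> (nat \<Rightarrow> nat \<Rightarrow> 'a) \<Rightarrow> (nat \<times> nat \<times> 'a) set \<Rightarrow> bool" where
  "minimum_cover n S L C \<longleftrightarrow>
     cover n S L C \<and> (\<forall>C'. cover n S L C' \<longrightarrow> card C \<le> card C')"

definition min_cover_size :: "nat \<Rightarrow> 'a set \<Rightarrow> (nat \<Rightarrow> nat \<Rightarrow> 'a) \<Rightarrow> nat" where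
  "min_cover_size n S L = (LEAST m. \<exists>C. cover n S L C \<and> card C = m)"

text \<open>
  The size condition is written \<open>card T + d = n\<close> rather than \<open>card T = n - d\<close>, because truncated
  subtraction would give the empty set every deficit \<open>d \<ge> n\<close>.
\<close>

definition partial_transversal ::
  "nat \<Rightarrow> 'a set \<Rightarrow> (nat \<Rightarrow> nat \<Rightarrow> 'a) \<Rightarrow> nat \<Rightarrow> (nat \<times> nat \<times> 'a) set \<Rightarrow> bool" where
  "partial_transversal n S L d T \<longleftrightarrow>
     T \<subseteq> entries n L \<and> card T + d = n \<and> (\<forall>l\<in>lines n S L. card (T \<inter> l) \<le> 1)"

definition min_deficit :: "nat \<Rightarrow> 'a set \<Rightarrow> (nat \<Rightarrow> nat \<Rightarrow> 'a) \<Rightarrow> nat" where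
  "min_deficit n S L = (LEAST d. \<exists>T. partial_transversal n S L d T)"

text \<open>Both minima range over nonempty sets, so the \<open>LEAST\<close> operators above are meaningful.\<close>

lemma partial_transversal_empty: "partial_transversal n S L n {}"
  by (simp add: partial_transversal_def)

lemma cover_entries:
  assumes "latin_square n S L" and "n \<ge> 1"
  shows "cover n S L (entries n L)"
proof -
  have "entries n L \<inter> row_line n L r \<noteq> {}" if "r < n" for r
  proof -
    have "(r, 0, L r 0) \<in> entries n L \<inter> row_line n L r"
      using that assms(2) by (auto simp: entries_def row_line_def)
    then show ?thesis by blast
  qed
  moreover have "entries n L \<inter> column_line n L c \<noteq> {}" if "c < n" for c
  proof -
    have "(0, c, L 0 c) \<in> entries n L \<inter> column_line n L c"
      using that assms(2) by (auto simp: entries_def column_line_def)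
    then show ?thesis by blast
  qed
  moreover have "entries n L \<inter> symbol_line n L s \<noteq> {}" if "s \<in> S" for s
  proof -
    have "0 < n" using assms(2) by simp
    have "\<forall>i<n. \<forall>s\<in>S. \<exists>!j. j < n \<and> L i j = s"
      using assms(1) by (simp add: latin_square_def)
    then have "\<exists>!j. j < n \<and> L 0 j = s"
      using \<open>0 < n\<close> that by (elim allE[of _ 0] impE) (assumption, erule bspec)
    then obtain j where "j < n" "L 0 j = s"
      by (elim ex1E conjE)
    then have "(0, j, s) \<in> entries n L \<inter> symbol_line n L s"
      using \<open>0 < n\<close> by (auto simp: entries_def symbol_line_def)
    then show ?thesis by blast
  qed
  ultimately show ?thesis
    by (simp add: cover_def lines_def ball_Un)
qed

end

theory Submission
  imports Defs
begin

text \<open>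
  Each line meets a cover of size \<open>n + a\<close>; deleting all but one entry of the cover from every line
  removes at most \<open>a\<close> entries for the rows, \<open>a\<close> for the columns and \<open>a\<close> for the symbols, and what
  is left is a partial transversal of deficit at most \<open>2 * a\<close>. A prescribed entry survives if it is
  the one kept in each of its lines. Conversely, a partial transversal of deficit \<open>d\<close> misses
  \<open>3 * d\<close> lines, equally many of each of the three kinds. Any two lines of different kinds share
  an entry, so the missed lines can be covered two at a time.
\<close>

section \<open>Coordinates of entries, and lines of different kinds meeting in an entry\<close>

abbreviation (input) row_of :: "nat \<times> nat \<times> 'a \<Rightarrow> nat" where
  "row_of e \<equiv> fst e"

abbreviation (input) column_of :: "nat \<times> nat \<times> 'a \<Rightarrow> nat" where
  "column_of e \<equiv> fst (snd e)"

abbreviation (input) symbol_of :: "nat \<times> nat \<times> 'a \<Rightarrow> 'a" where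
  "symbol_of e \<equiv> snd (snd e)"

lemma finite_entries: "finite (entries n L)"
proof -
  have "entries n L = (\<lambda>(i, j). (i, j, L i j)) ` ({..<n} \<times> {..<n})"
    by (auto simp: entries_def)
  then show ?thesis by simp
qed

lemma entries_images:
  assumes "latin_square n S L"
  shows "row_of ` entries n L \<subseteq> {..<n}"
    and "column_of ` entries n L \<subseteq> {..<n}"
    and "symbol_of ` entries n L \<subseteq> S"
proof -
  have "\<forall>i<n. \<forall>j<n. L i j \<in> S" using assms by (simp add: latin_square_def)
  then show "row_of ` entries n L \<subseteq> {..<n}" "column_of ` entries n L \<subseteq> {..<n}"
    "symbol_of ` entries n L \<subseteq> S"
    by (auto simp: entries_def)
qed

lemma ex_entry_row_column:
  "r < n \<Longrightarrow> c < n \<Longrightarrow> \<exists>e\<in>entries n L. row_of e = r \<and> column_of e = c"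
  by (force simp: entries_def)

lemma ex_entry_row_symbol:
  assumes "latin_square n S L" "r < n" "s \<in> S"
  shows "\<exists>e\<in>entries n L. row_of e = r \<and> symbol_of e = s"
proof -
  have "\<exists>!j. j < n \<and> L r j = s" using assms by (simp add: latin_square_def)
  then show ?thesis using assms(2) by (force simp: entries_def)
qed

lemma ex_entry_column_symbol:
  assumes "latin_square n S L" "c < n" "s \<in> S"
  shows "\<exists>e\<in>entries n L. column_of e = c \<and> symbol_of e = s"
proof -
  have "\<exists>!i. i < n \<and> L i c = s" using assms by (simp add: latin_square_def)
  then show ?thesis using assms(2) by (force simp: entries_def)
qed

section \<open>Covers and partial transversals in terms of the three coordinates\<close>

text \<open>A line meets \<open>C\<close> exactly when its index is a value of the corresponding
  coordinate on \<open>C\<close>. The equalities also record that entries take no other values, so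
  each image has exactly \<open>n\<close> elements; the deletion count below relies on this.\<close>

lemma cover_iff_images:
  assumes "latin_square n S L"
  shows "cover n S L C \<longleftrightarrow> C \<subseteq> entries n L \<and>
    row_of ` C = {..<n} \<and> column_of ` C = {..<n} \<and> symbol_of ` C = S"
proof (cases "C \<subseteq> entries n L")
  case True
  have "(\<forall>r\<in>{..<n}. C \<inter> row_line n L r \<noteq> {}) \<longleftrightarrow> {..<n} \<subseteq> row_of ` C"
    using True by (force simp: row_line_def)
  moreover have "(\<forall>c\<in>{..<n}. C \<inter> column_line n L c \<noteq> {}) \<longleftrightarrow> {..<n} \<subseteq> column_of ` C"
    using True by (force simp: column_line_def)
  moreover have "(\<forall>s\<in>S. C \<inter> symbol_line n L s \<noteq> {}) \<longleftrightarrow> S \<subseteq> symbol_of ` C"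
    using True by (force simp: symbol_line_def)
  moreover have "row_of ` C = {..<n} \<longleftrightarrow> {..<n} \<subseteq> row_of ` C"
    "column_of ` C = {..<n} \<longleftrightarrow> {..<n} \<subseteq> column_of ` C"
    "symbol_of ` C = S \<longleftrightarrow> S \<subseteq> symbol_of ` C"
    using entries_images[OF assms] True by blast+
  ultimately show ?thesis
    using True by (simp add: cover_def lines_def ball_Un)
qed (simp add: cover_def)

text \<open>A line meets \<open>T\<close> in a fibre of one coordinate, so this turns the
  at-most-once condition into injectivity. The inclusion in \<open>A\<close> ensures that no fibre
  escapes the quantifier.\<close>

lemma fibres_le_one_iff_inj_on:
  assumes "finite T" "f ` T \<subseteq> A"
  shows "(\<forall>a\<in>A. card {e \<in> T. f e = a} \<le> 1) \<longleftrightarrow> inj_on f T"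
  using assms by (auto simp: inj_on_def card_le_Suc0_iff_eq)

lemma partial_transversal_iff_inj_on:
  assumes "latin_square n S L"
  shows "partial_transversal n S L d T \<longleftrightarrow> T \<subseteq> entries n L \<and> card T + d = n \<and>
    inj_on row_of T \<and> inj_on column_of T \<and> inj_on symbol_of T"
proof (cases "T \<subseteq> entries n L")
  case True
  have fin: "finite T" using True finite_entries finite_subset by blast
  have "T \<inter> row_line n L r = {e \<in> T. row_of e = r}"
    "T \<inter> column_line n L r = {e \<in> T. column_of e = r}"
    "T \<inter> symbol_line n L s = {e \<in> T. symbol_of e = s}" for r s
    using True by (auto simp: row_line_def column_line_def symbol_line_def)
  moreover have "row_of ` T \<subseteq> {..<n}" "column_of ` T \<subseteq> {..<n}" "symbol_of ` T \<subseteq> S"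
    using entries_images[OF assms] True by blast+
  ultimately show ?thesis
    using True fin fibres_le_one_iff_inj_on[of T row_of "{..<n}"]
      fibres_le_one_iff_inj_on[of T column_of "{..<n}"]
      fibres_le_one_iff_inj_on[of T symbol_of S]
    by (simp add: partial_transversal_def lines_def ball_Un)
qed (simp add: partial_transversal_def)

section \<open>From covers to partial transversals\<close>

text \<open>This treats one kind of line: keep one representative of each fibre of \<open>f\<close>,
  choosing \<open>e\<close> in its own fibre, and let \<open>D\<close> be the rest. There are as
  many representatives as values of \<open>f\<close>, which gives the exact size of
  \<open>D\<close>.\<close>

lemma inj_on_after_deletion:
  assumes "finite C" "e \<in> C"
  obtains D where "D \<subseteq> C - {e}" "card D = card C - card (f ` C)" "inj_on f (C - D)"
proof
  \<comment> \<open>\<open>rep\<close> is a section of \<open>f\<close> passing through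
    \<open>e\<close>; hence \<open>f\<close> is injective on its image \<open>X\<close>, and
    \<open>X\<close> contains \<open>e\<close>.\<close>
  define rep where "rep y = (if y = f e then e else inv_into C f y)" for y
  have rep: "rep y \<in> C" "f (rep y) = y" if "y \<in> f ` C" for y
    using that assms(2) by (auto simp: rep_def inv_into_into f_inv_into_f)
  define X where "X = rep ` f ` C"
  have "inj_on rep (f ` C)" by (metis inj_onI rep(2))
  then have cardX: "card X = card (f ` C)" by (simp add: X_def card_image)
  have XC: "X \<subseteq> C" using rep(1) by (auto simp: X_def)
  have "e \<in> X" using assms(2) by (force simp: X_def rep_def)
  then show "C - X \<subseteq> C - {e}" by blast
  show "card (C - X) = card C - card (f ` C)"
    using XC assms(1) cardX by (metis card_Diff_subset finite_subset)
  have "C - (C - X) = X" using XC by blast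
  moreover have "inj_on f X" using rep(2) by (auto simp: X_def intro!: inj_onI)
  ultimately show "inj_on f (C - (C - X))" by simp
qed

text \<open>With \<open>a = card C - n\<close>, the three deletions leave at least
  \<open>n + a - 3 * a\<close> entries, so the deficit is at most \<open>2 * a\<close>. The entry
  \<open>e\<close> is spared by each deletion.\<close>

lemma cover_contains_partial_transversal:
  assumes ls: "latin_square n S L" and C: "cover n S L C" and e: "e \<in> C"
  obtains T t where "T \<subseteq> C" "e \<in> T" "partial_transversal n S L t T" "2 * n + t \<le> 2 * card C"
proof -
  have CE: "C \<subseteq> entries n L" and row: "row_of ` C = {..<n}"
    and col: "column_of ` C = {..<n}" and sym: "symbol_of ` C = S"
    using C by (auto simp: cover_iff_images[OF ls])
  have fin: "finite C" using CE finite_entries finite_subset by blast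
  have cS: "card S = n" using ls by (simp add: latin_square_def)
  obtain D1 where D1: "D1 \<subseteq> C - {e}" "card D1 = card C - n" "inj_on row_of (C - D1)"
    using inj_on_after_deletion[OF fin e, of row_of] by (auto simp: row)
  obtain D2 where D2: "D2 \<subseteq> C - {e}" "card D2 = card C - n" "inj_on column_of (C - D2)"
    using inj_on_after_deletion[OF fin e, of column_of] by (auto simp: col)
  obtain D3 where D3: "D3 \<subseteq> C - {e}" "card D3 = card C - n" "inj_on symbol_of (C - D3)"
    using inj_on_after_deletion[OF fin e, of symbol_of] by (auto simp: sym cS)
  define D where "D = D1 \<union> D2 \<union> D3"
  define T where "T = C - D"
  have DC: "D \<subseteq> C" using D1 D2 D3 by (auto simp: D_def)
  \<comment> \<open>Makes the truncated \<open>card C - n\<close> a true difference in the final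
    count.\<close>
  have nC: "n \<le> card C" using card_image_le[OF fin, of row_of] by (simp add: row)
  have "card D \<le> card D1 + card D2 + card D3"
    unfolding D_def by (meson add_mono card_Un_le order_refl order_trans)
  then have cD: "card D \<le> 3 * (card C - n)" using D1 D2 D3 by simp
  have cT: "card T = card C - card D"
    using DC fin by (simp add: T_def card_Diff_subset finite_subset)
  have injs: "inj_on row_of T" "inj_on column_of T" "inj_on symbol_of T"
    using D1(3) D2(3) D3(3) by (auto simp: T_def D_def elim!: inj_on_subset)
  have "T \<subseteq> C" by (auto simp: T_def)
  then have "row_of ` T \<subseteq> {..<n}" using row by blast
  \<comment> \<open>Likewise for \<open>n - card T\<close>, which is then the deficit of
    \<open>T\<close>.\<close>
  then have cTn: "card T \<le> n" using injs(1) by (metis card_inj_on_le card_lessThan finite_lessThan)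
  show thesis
  proof
    show "T \<subseteq> C" by fact
    show "e \<in> T" using e D1(1) D2(1) D3(1) by (auto simp: T_def D_def)
    show "partial_transversal n S L (n - card T) T"
      using injs cTn \<open>T \<subseteq> C\<close> CE by (auto simp: partial_transversal_iff_inj_on[OF ls])
    show "2 * n + (n - card T) \<le> 2 * card C" using cT cD nC cTn by linarith
  qed
qed

section \<open>The minimum deficit and the lower bound on cover sizes\<close>

lemma min_deficit_le: "partial_transversal n S L t T \<Longrightarrow> min_deficit n S L \<le> t"
  unfolding min_deficit_def by (rule Least_le) blast

lemma ex_partial_transversal_min_deficit:
  "\<exists>T. partial_transversal n S L (min_deficit n S L) T"
  unfolding min_deficit_def by (rule LeastI) (use partial_transversal_empty in blast)

text \<open>Dropping entries keeps the coordinates injective and raises the deficit. For odd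
  \<open>d\<close> this reaches the deficit \<open>d + 1\<close> when a cover yields deficit
  \<open>d\<close>.\<close>

lemma partial_transversal_subset:
  assumes ls: "latin_square n S L" and T: "partial_transversal n S L t T" and "t \<le> u" "u \<le> n"
  obtains T' where "T' \<subseteq> T" "partial_transversal n S L u T'"
proof -
  have "n - u \<le> card T" using T assms(3) by (auto simp: partial_transversal_def)
  then obtain T' where "T' \<subseteq> T" "card T' = n - u" by (meson obtain_subset_with_card_n)
  then have "partial_transversal n S L u T'"
    using T assms(4) by (auto simp: partial_transversal_iff_inj_on[OF ls] intro: inj_on_subset)
  with \<open>T' \<subseteq> T\<close> show thesis by (rule that)
qed

text \<open>A single entry is a partial transversal. The strict inequality makes
  \<open>d + 1\<close> an admissible deficit.\<close>

lemma min_deficit_less: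
  assumes "latin_square n S L" "n \<ge> 1"
  shows "min_deficit n S L < n"
proof -
  have "partial_transversal n S L (n - 1) {(0, 0, L 0 0)}"
    using assms(2) by (auto simp: partial_transversal_iff_inj_on[OF assms(1)] entries_def)
  then show ?thesis using min_deficit_le assms(2) by fastforce
qed

text \<open>A cover of size \<open>n + a\<close> contains a partial transversal of deficit at most
  \<open>2 * a\<close>, so the minimum deficit is at most \<open>2 * a\<close>; halving rounds
  up.\<close>

lemma card_cover_ge:
  assumes "latin_square n S L" "n \<ge> 1" "cover n S L C"
  shows "n + (min_deficit n S L + 1) div 2 \<le> card C"
proof -
  have "0 \<in> row_of ` C" using assms by (simp add: cover_iff_images)
  then obtain e where "e \<in> C" by blast
  then obtain T t where "partial_transversal n S L t T" "2 * n + t \<le> 2 * card C"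
    using cover_contains_partial_transversal[OF assms(1,3)] by metis
  then show ?thesis using min_deficit_le[of n S L t T] by linarith
qed

section \<open>From partial transversals to covers\<close>

text \<open>Injectivity of \<open>f\<close> on \<open>T\<close> leaves exactly \<open>d\<close>
  missed indices. Numbering them lets the missed lines of the three kinds be paired by
  position.\<close>

lemma enumerate_unused:
  assumes "finite A" "card A = n" "f ` T \<subseteq> A" "inj_on f T" "card T + d = n"
  obtains u :: "nat \<Rightarrow> 'b" where "u ` {..<d} = A - f ` T"
proof -
  have "finite (f ` T)" using assms by (meson finite_subset)
  then have "card (A - f ` T) = d"
    using assms by (simp add: card_Diff_subset card_image)
  then show thesis
    using that ex_bij_betw_nat_finite[of "A - f ` T"] assms(1)
    by (metis atLeast0LessThan bij_betw_imp_surj_on finite_Diff)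
qed

lemma subset_image_Un_enumerated:
  assumes "u ` I = A - f ` T" "\<And>i. i \<in> I \<Longrightarrow> u i \<in> f ` U"
  shows "A \<subseteq> f ` (T \<union> U)"
proof -
  have "A - f ` T \<subseteq> f ` U" using assms(2) unfolding assms(1)[symmetric] by (rule image_subsetI)
  then show ?thesis unfolding image_Un by (simp add: Diff_subset_conv)
qed

text \<open>The \<open>d\<close> missed rows, columns and symbols are paired as follows: the first
  \<open>h\<close> rows with the first \<open>h\<close> columns, the last \<open>l\<close> rows with
  the first \<open>l\<close> symbols, and the last \<open>l\<close> columns with the next
  \<open>l\<close> symbols. At most one symbol remains.\<close>

lemma partial_transversal_extends_to_cover:
  assumes ls: "latin_square n S L" and n: "n \<ge> 1" and T: "partial_transversal n S L d T"
  obtains C where "cover n S L C" "T \<subseteq> C" "card C \<le> n + (d + 1) div 2"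
proof -
  have TE: "T \<subseteq> entries n L" and cT: "card T + d = n"
    and injs: "inj_on row_of T" "inj_on column_of T" "inj_on symbol_of T"
    using T by (auto simp: partial_transversal_iff_inj_on[OF ls])
  have img: "row_of ` T \<subseteq> {..<n}" "column_of ` T \<subseteq> {..<n}" "symbol_of ` T \<subseteq> S"
    using entries_images[OF ls] TE by blast+
  have S: "finite S" "card S = n" using ls by (auto simp: latin_square_def)
  obtain r where r: "r ` {..<d} = {..<n} - row_of ` T"
    using enumerate_unused[OF _ _ img(1) injs(1) cT] by auto
  obtain c where c: "c ` {..<d} = {..<n} - column_of ` T"
    using enumerate_unused[OF _ _ img(2) injs(2) cT] by auto
  obtain s where s: "s ` {..<d} = S - symbol_of ` T"
    using enumerate_unused[OF S img(3) injs(3) cT] by auto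
  have rn: "r i < n" and cn: "c i < n" and sS: "s i \<in> S" if "i < d" for i
    using r c s that by blast+
  \<comment> \<open>\<open>l\<close> and \<open>h\<close> are the halves of \<open>d\<close> rounded
    down and up. Thus \<open>h + l = d\<close> exhausts rows and columns, while \<open>2 * l\<close>
    symbols are used, all of them if \<open>d\<close> is even.\<close>
  define l where "l = d div 2"
  define h where "h = d - l"
  have lh: "l \<le> h" "2 * l \<le> d" "h + l = d" "h = (d + 1) div 2" by (auto simp: l_def h_def)
  have "\<forall>i\<in>{..<h}. \<exists>e\<in>entries n L. row_of e = r i \<and> column_of e = c i"
    using rn cn lh by (intro ballI ex_entry_row_column) auto
  then obtain rc where rc: "\<And>i. i < h \<Longrightarrow> rc i \<in> entries n L \<and> row_of (rc i) = r i \<and> column_of (rc i) = c i"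
    by (metis lessThan_iff)
  have "\<forall>i\<in>{..<l}. \<exists>e\<in>entries n L. row_of e = r (h + i) \<and> symbol_of e = s i"
    using rn sS lh by (intro ballI ex_entry_row_symbol[OF ls]) auto
  then obtain rs where rs: "\<And>i. i < l \<Longrightarrow> rs i \<in> entries n L \<and> row_of (rs i) = r (h + i) \<and> symbol_of (rs i) = s i"
    by (metis lessThan_iff)
  have "\<forall>i\<in>{..<l}. \<exists>e\<in>entries n L. column_of e = c (h + i) \<and> symbol_of e = s (l + i)"
    using cn sS lh by (intro ballI ex_entry_column_symbol[OF ls]) auto
  then obtain cs where cs: "\<And>i. i < l \<Longrightarrow> cs i \<in> entries n L \<and> column_of (cs i) = c (h + i) \<and> symbol_of (cs i) = s (l + i)"
    by (metis lessThan_iff)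
  \<comment> \<open>If \<open>d\<close> is odd, one missed symbol is left over and is covered on its own, in row \<open>0\<close>.\<close>
  have "\<forall>i\<in>{2 * l..<d}. \<exists>e\<in>entries n L. row_of e = 0 \<and> symbol_of e = s i"
    using n sS by (intro ballI ex_entry_row_symbol[OF ls]) auto
  then obtain x where x: "\<And>i. 2 * l \<le> i \<Longrightarrow> i < d \<Longrightarrow> x i \<in> entries n L \<and> symbol_of (x i) = s i"
    by (metis atLeastLessThan_iff)
  define U where "U = rc ` {..<h} \<union> rs ` {..<l} \<union> cs ` {..<l} \<union> x ` {2 * l..<d}"
  have "card U \<le> card (rc ` {..<h}) + card (rs ` {..<l}) + card (cs ` {..<l}) + card (x ` {2 * l..<d})"
    unfolding U_def by (meson add_mono card_Un_le order_refl order_trans)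
  also have "\<dots> \<le> h + l + l + (d - 2 * l)"
    using card_image_le[of "{..<h}" rc] card_image_le[of "{..<l}" rs]
      card_image_le[of "{..<l}" cs] card_image_le[of "{2 * l..<d}" x] by simp
  finally have cU: "card U \<le> d + h" using lh by simp
  have UE: "U \<subseteq> entries n L" using rc rs cs x by (auto simp: U_def)
  have row: "r i \<in> row_of ` U" if "i \<in> {..<d}" for i
  proof (cases "i < h")
    case True
    then show ?thesis using rc[of i] by (force simp: U_def)
  next
    case False
    then have "i = h + (i - h)" "i - h < l" using that lh by auto
    then have "rs (i - h) \<in> U" "row_of (rs (i - h)) = r i" using rs[of "i - h"] by (auto simp: U_def)
    then show ?thesis by (metis imageI)
  qed
  have col: "c i \<in> column_of ` U" if "i \<in> {..<d}" for i
  proof (cases "i < h")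
    case True
    then have "rc i \<in> U" "column_of (rc i) = c i" using rc[of i] by (auto simp: U_def)
    then show ?thesis by (metis image_eqI)
  next
    case False
    then have "i = h + (i - h)" "i - h < l" using that lh by auto
    then have "cs (i - h) \<in> U" "column_of (cs (i - h)) = c i" using cs[of "i - h"] by (auto simp: U_def)
    then show ?thesis by (metis image_eqI)
  qed
  have sym: "s i \<in> symbol_of ` U" if "i \<in> {..<d}" for i
  proof -
    \<comment> \<open>The three ranges are the symbols paired with rows, those paired with columns,
      and the leftover one for odd \<open>d\<close>.\<close>
    consider "i < l" | "l \<le> i" "i < 2 * l" | "2 * l \<le> i" by linarith
    then have "\<exists>e\<in>U. symbol_of e = s i"
    proof cases
      case 1
      then show ?thesis using rs[of i] by (auto simp: U_def)
    next
      case 2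
      then have "i = l + (i - l)" "i - l < l" by auto
      then have "cs (i - l) \<in> U" "symbol_of (cs (i - l)) = s i" using cs[of "i - l"] by (auto simp: U_def)
      then show ?thesis by blast
    next
      case 3
      then show ?thesis using x[of i] that by (auto simp: U_def)
    qed
    then show ?thesis by (metis image_eqI)
  qed
  show thesis
  proof
    have TUE: "T \<union> U \<subseteq> entries n L" using TE UE by blast
    have "{..<n} \<subseteq> row_of ` (T \<union> U)" "{..<n} \<subseteq> column_of ` (T \<union> U)"
      "S \<subseteq> symbol_of ` (T \<union> U)"
      using subset_image_Un_enumerated[OF r row] subset_image_Un_enumerated[OF c col]
        subset_image_Un_enumerated[OF s sym] by blast+
    moreover have "row_of ` (T \<union> U) \<subseteq> {..<n}" "column_of ` (T \<union> U) \<subseteq> {..<n}"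
      "symbol_of ` (T \<union> U) \<subseteq> S"
      by (rule order_trans[OF image_mono[OF TUE] entries_images(1)[OF ls]]
          order_trans[OF image_mono[OF TUE] entries_images(2)[OF ls]]
          order_trans[OF image_mono[OF TUE] entries_images(3)[OF ls]])+
    ultimately show "cover n S L (T \<union> U)"
      unfolding cover_iff_images[OF ls] by (intro conjI TUE subset_antisym)
    \<comment> \<open>\<open>T\<close> has \<open>n - d\<close> entries and \<open>U\<close> at most
      \<open>d + h\<close>, with \<open>h = (d + 1) div 2\<close>.\<close>
    show "card (T \<union> U) \<le> n + (d + 1) div 2"
      using card_Un_le[of T U] cU cT lh by linarith
    show "T \<subseteq> T \<union> U" by (rule Un_upper1)
  qed
qed

section \<open>Minimum covers and the four claims\<close>

text \<open>Extending a partial transversal of minimum deficit attains the lower bound on cover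
  sizes, so being minimum is a matter of size alone.\<close>

lemma minimum_cover_iff_card:
  assumes "latin_square n S L" "n \<ge> 1"
  shows "minimum_cover n S L C \<longleftrightarrow>
    cover n S L C \<and> card C = n + (min_deficit n S L + 1) div 2"
proof -
  obtain T where "partial_transversal n S L (min_deficit n S L) T"
    using ex_partial_transversal_min_deficit by blast
  then obtain C' where "cover n S L C'" "card C' \<le> n + (min_deficit n S L + 1) div 2"
    using partial_transversal_extends_to_cover[OF assms] by metis
  then have "card C = n + (min_deficit n S L + 1) div 2" if "minimum_cover n S L C"
    using that card_cover_ge[OF assms, of C] by (fastforce simp: minimum_cover_def)
  then show ?thesis
    using card_cover_ge[OF assms] by (auto simp: minimum_cover_def)
qed

lemma min_cover_size_eq_card:
  "minimum_cover n S L C \<Longrightarrow> min_cover_size n S L = card C"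
  unfolding min_cover_size_def minimum_cover_def by (rule Least_equality) auto

theorem theorem2p5:
  fixes n d :: nat and S :: "'a set" and L :: "nat \<Rightarrow> nat \<Rightarrow> 'a"
  assumes "latin_square n S L"
    and "n \<ge> 2"
    and "min_deficit n S L = d"
  shows "int (min_cover_size n S L) = int n + \<lceil>real d / 2\<rceil> \<and>
    (\<forall>T. partial_transversal n S L d T \<longrightarrow> (\<exists>C. minimum_cover n S L C \<and> T \<subseteq> C)) \<and>
    (\<forall>C. minimum_cover n S L C \<longrightarrow>
       (\<exists>T\<subseteq>C. partial_transversal n S L (if even d then d else d + 1) T)) \<and>
    (even d \<longrightarrow> (\<forall>C. minimum_cover n S L C \<longrightarrow>
       (\<forall>e\<in>C. \<exists>T\<subseteq>C. partial_transversal n S L d T \<and> e \<in> T)))"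
proof -
  note ls = assms(1)
  have n: "n \<ge> 1" using assms(2) by simp
  have min_iff: "minimum_cover n S L C \<longleftrightarrow> cover n S L C \<and> card C = n + (d + 1) div 2" for C
    using minimum_cover_iff_card[OF ls n] assms(3) by simp
  have extend: "\<exists>C. minimum_cover n S L C \<and> T \<subseteq> C" if T: "partial_transversal n S L d T" for T
  proof -
    obtain C where "cover n S L C" "T \<subseteq> C" "card C \<le> n + (d + 1) div 2"
      using partial_transversal_extends_to_cover[OF ls n T] .
    moreover have "n + (d + 1) div 2 \<le> card C"
      using card_cover_ge[OF ls n \<open>cover n S L C\<close>] assms(3) by simp
    ultimately show ?thesis using min_iff by auto
  qed
  \<comment> \<open>This serves both containment claims: \<open>e\<close> is prescribed in one and
    arbitrary in the other. The bounds force \<open>t = d\<close> for even \<open>d\<close> and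
    leave \<open>d\<close> or \<open>d + 1\<close> for odd \<open>d\<close>.\<close>
  have contain: "\<exists>T t. T \<subseteq> C \<and> e \<in> T \<and> partial_transversal n S L t T \<and>
      d \<le> t \<and> t \<le> (if even d then d else d + 1)"
    if min: "minimum_cover n S L C" and e: "e \<in> C" for C e
  proof -
    have C: "cover n S L C" "card C = n + (d + 1) div 2" using min min_iff by auto
    obtain T t where T: "T \<subseteq> C" "e \<in> T" "partial_transversal n S L t T" "2 * n + t \<le> 2 * card C"
      using cover_contains_partial_transversal[OF ls C(1) e] .
    have "t \<le> 2 * ((d + 1) div 2)" using T(4) C(2) by simp
    then have "t \<le> (if even d then d else d + 1)" by (auto elim!: evenE oddE)
    moreover have "d \<le> t" using min_deficit_le[OF T(3)] assms(3) by simp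
    ultimately show ?thesis using T(1-3) by blast
  qed
  have "int (min_cover_size n S L) = int n + \<lceil>real d / 2\<rceil>"
  proof -
    obtain T where "partial_transversal n S L d T"
      using ex_partial_transversal_min_deficit assms(3) by blast
    then obtain C where C: "minimum_cover n S L C" using extend by blast
    have "\<lceil>real d / 2\<rceil> = int ((d + 1) div 2)" by (rule ceiling_unique) linarith+
    then show ?thesis using min_iff C min_cover_size_eq_card[OF C] by simp
  qed
  moreover have "\<exists>T\<subseteq>C. partial_transversal n S L (if even d then d else d + 1) T"
    if C: "minimum_cover n S L C" for C
  proof -
    \<comment> \<open>A minimum cover is nonempty, so some entry is available to be
      prescribed.\<close>
    have "card C \<noteq> 0" using C min_iff n by simp
    then have "C \<noteq> {}" by auto
    then obtain e where "e \<in> C" by blast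
    then obtain T t where T: "T \<subseteq> C" "partial_transversal n S L t T"
      "t \<le> (if even d then d else d + 1)" using contain[OF C] by metis
    have "(if even d then d else d + 1) \<le> n" using min_deficit_less[OF ls n] assms(3) by simp
    from partial_transversal_subset[OF ls T(2,3) this] show ?thesis
      using T(1) by (metis order_trans)
  qed
  moreover have "\<exists>T\<subseteq>C. partial_transversal n S L d T \<and> e \<in> T"
    if "even d" and "minimum_cover n S L C" "e \<in> C" for C e
  proof -
    obtain T t where T: "T \<subseteq> C" "e \<in> T" "partial_transversal n S L t T" "d \<le> t" "t \<le> d"
      using contain[OF \<open>minimum_cover n S L C\<close> \<open>e \<in> C\<close>] \<open>even d\<close> by (simp only: if_True) blast
    then have "t = d" by simp
    then show ?thesis using T(1-3) by blast
  qed
  ultimately show ?thesis using extend by blast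
qed

end
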